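(* Let $P,P',P'',Q,S_1,S_2$ be programs and $B$ a Boolean expression such that $P'\equiv_B(P,B)$ and $P''\equiv_B(P,\neg B)$. If the operational triples $\{|P'|\}\ S_1\ \{|Q|\}$ and $\{|P''|\}\ S_2\ \{|Q|\}$ hold, then $\{|P|\}\ \mathbf{if}\ B\ \mathbf{then}\ S_1\ \mathbf{else}\ S_2\ \mathbf{fi}\ \{|Q|\}$ holds.
   Context: Programs are statements of a sequential imperative language with a standard small-step operational semantics over program states. $\mathrm{behs}(P)$ is the set of pairs (initial state, final state) of finite terminating executions of $P$; $(s,u)\in\mathrm{behs}(P;Q)$ iff there is $t$ with $(s,t)\in\mathrm{behs}(P)$ and $(t,u)\in\mathrm{behs}(Q)$. For a state $s$ and Boolean expression $B$, $s(B)\in\{\mathit{tt},\mathit{ff}\}$ is the (side-effect-free) value of $B$ in $s$. The statement $\mathbf{if}\ B\ \mathbf{then}\ S_1\ \mathbf{else}\ S_2\ \mathbf{fi}$ started in state $s$ executes $S_1$ from $s$ if $s(B)=\mathit{tt}$ and $S_2$ from $s$ otherwise. The post-state set is $\mathrm{pst}(P)=\{t:\exists s,\ (s,t)\in\mathrm{behs}(P)\}$. The operational triple $\{|P|\}\ S\ \{|Q|\}$ means $\mathrm{pst}(P;S)\subseteq\mathrm{pst}(Q)$. For programs $P',P$ and Boolean expression $B$, $P'\equiv_B(P,B)$ means $\mathrm{pst}(P')=\mathrm{pst}(P)\cap\{s : s(B)=\mathit{tt}\}$. *)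

theory Defs
  imports Main
begin

type_synonym vname = string
type_synonym state = "vname \<Rightarrow> int"

datatype aexp = N int | V vname | Plus aexp aexp | Minus aexp aexp | Times aexp aexp

datatype bexp = Bc bool | Not bexp | And bexp bexp | Less aexp aexp | Eq aexp aexp

fun aval :: "aexp \<Rightarrow> state \<Rightarrow> int" where
  "aval (N n) s = n"
| "aval (V x) s = s x"
| "aval (Plus a b) s = aval a s + aval b s"
| "aval (Minus a b) s = aval a s - aval b s"
| "aval (Times a b) s = aval a s * aval b s"

fun bval :: "bexp \<Rightarrow> state \<Rightarrow> bool" where
  "bval (Bc v) s = v"
| "bval (Not b) s = (\<not> bval b s)"
| "bval (And b1 b2) s = (bval b1 s \<and> bval b2 s)"
| "bval (Less a b) s = (aval a s < aval b s)"
| "bval (Eq a b) s = (aval a s = aval b s)"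

datatype com = SKIP
  | Assign vname aexp
  | Seq com com
  | If bexp com com
  | While bexp com

inductive small_step :: "com \<times> state \<Rightarrow> com \<times> state \<Rightarrow> bool" (infix "\<rightarrow>" 55) where
  Assign: "(Assign x a, s) \<rightarrow> (SKIP, s(x := aval a s))"
| Seq1: "(Seq SKIP c2, s) \<rightarrow> (c2, s)"
| Seq2: "(c1, s) \<rightarrow> (c1', s') \<Longrightarrow> (Seq c1 c2, s) \<rightarrow> (Seq c1' c2, s')"
| IfTrue: "bval b s \<Longrightarrow> (If b c1 c2, s) \<rightarrow> (c1, s)"
| IfFalse: "\<not> bval b s \<Longrightarrow> (If b c1 c2, s) \<rightarrow> (c2, s)"
| While: "(While b c, s) \<rightarrow> (If b (Seq c (While b c)) SKIP, s)"

definition behs :: "com \<Rightarrow> (state \<times> state) set" where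
  "behs P = {(s, t). small_step\<^sup>*\<^sup>* (P, s) (SKIP, t)}"

definition pst :: "com \<Rightarrow> state set" where
  "pst P = {t. \<exists>s. (s, t) \<in> behs P}"

definition op_triple :: "com \<Rightarrow> com \<Rightarrow> com \<Rightarrow> bool" where
  "op_triple P S Q \<longleftrightarrow> pst (Seq P S) \<subseteq> pst Q"

definition restr_equiv :: "com \<Rightarrow> com \<Rightarrow> bexp \<Rightarrow> bool" where
  "restr_equiv P' P B \<longleftrightarrow> pst P' = pst P \<inter> {s. bval B s}"

end

theory Submission
  imports Defs
begin

text \<open>Both branches of the conditional start in a post-state t of P, and the test picks the
  branch: if B holds at t then t is a post-state of P', so the run through S1 is a run of P';S1,
  and symmetrically for P'' and S2. Hence the post-states of P;if B then S1 else S2 fi are those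
  of P';S1 together with those of P'';S2, both of which lie in the post-states of Q.\<close>

lemma small_steps_Seq_left:
  "small_step\<^sup>*\<^sup>* (c1, s) (c1', s') \<Longrightarrow> small_step\<^sup>*\<^sup>* (Seq c1 c2, s) (Seq c1' c2, s')"
proof (induction rule: rtranclp_induct2)
  case refl
  then show ?case by simp
next
  case (step c s c' s')
  then show ?case by (meson rtranclp.rtrancl_into_rtrancl small_step.Seq2)
qed

lemma small_steps_Seq_SKIP_split:
  "small_step\<^sup>*\<^sup>* (Seq c1 c2, s) (SKIP, u) \<Longrightarrow>
     \<exists>t. small_step\<^sup>*\<^sup>* (c1, s) (SKIP, t) \<and> small_step\<^sup>*\<^sup>* (c2, t) (SKIP, u)"
proof (induction "Seq c1 c2" s arbitrary: c1 rule: converse_rtranclp_induct2)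
  case (step s c' s')
  from step.hyps(1) show ?case
  proof (cases rule: small_step.cases)
    case Seq1
    then show ?thesis using step by auto
  next
    case (Seq2 c1')
    with step obtain t where "small_step\<^sup>*\<^sup>* (c1', s') (SKIP, t)"
      and "small_step\<^sup>*\<^sup>* (c2, t) (SKIP, u)"
      by blast
    then show ?thesis using Seq2 by (meson converse_rtranclp_into_rtranclp)
  qed
qed

lemma behs_Seq:
  "(s, u) \<in> behs (Seq c1 c2) \<longleftrightarrow> (\<exists>t. (s, t) \<in> behs c1 \<and> (t, u) \<in> behs c2)"
proof
  assume "(s, u) \<in> behs (Seq c1 c2)"
  then show "\<exists>t. (s, t) \<in> behs c1 \<and> (t, u) \<in> behs c2"
    by (auto simp: behs_def dest: small_steps_Seq_SKIP_split)
next
  assume "\<exists>t. (s, t) \<in> behs c1 \<and> (t, u) \<in> behs c2"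
  then obtain t where run1: "small_step\<^sup>*\<^sup>* (c1, s) (SKIP, t)"
    and run2: "small_step\<^sup>*\<^sup>* (c2, t) (SKIP, u)"
    by (auto simp: behs_def)
  have "small_step\<^sup>*\<^sup>* (Seq c1 c2, s) (Seq SKIP c2, t)"
    using run1 by (rule small_steps_Seq_left)
  also have "small_step (Seq SKIP c2, t) (c2, t)"
    by (rule small_step.Seq1)
  finally show "(s, u) \<in> behs (Seq c1 c2)"
    using run2 by (simp add: behs_def)
qed

lemma behs_If:
  "(s, u) \<in> behs (If b c1 c2) \<longleftrightarrow> (s, u) \<in> behs (if bval b s then c1 else c2)"
proof
  assume "(s, u) \<in> behs (If b c1 c2)"
  then obtain z where "small_step (If b c1 c2, s) z" "small_step\<^sup>*\<^sup>* z (SKIP, u)"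
    by (auto simp: behs_def elim: converse_rtranclpE)
  then show "(s, u) \<in> behs (if bval b s then c1 else c2)"
    by (cases rule: small_step.cases) (auto simp: behs_def)
next
  assume "(s, u) \<in> behs (if bval b s then c1 else c2)"
  then show "(s, u) \<in> behs (If b c1 c2)"
    by (cases "bval b s")
      (auto simp: behs_def intro: converse_rtranclp_into_rtranclp small_step.IfTrue small_step.IfFalse)
qed

lemma pst_Seq: "pst (Seq P S) = behs S `` pst P"
  by (auto simp: pst_def behs_Seq)

lemma pst_Seq_If:
  "pst (Seq P (If B S1 S2)) =
     behs S1 `` (pst P \<inter> {s. bval B s}) \<union> behs S2 `` (pst P \<inter> {s. \<not> bval B s})"
  by (auto simp: pst_Seq behs_If split: if_splits)

theorem theorem3:
  fixes P P' P'' Q S1 S2 :: com and B :: bexp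
  assumes "restr_equiv P' P B"
    and "restr_equiv P'' P (Not B)"
    and "op_triple P' S1 Q"
    and "op_triple P'' S2 Q"
  shows "op_triple P (If B S1 S2) Q"
proof -
  have "pst (Seq P (If B S1 S2)) = pst (Seq P' S1) \<union> pst (Seq P'' S2)"
    using assms(1,2) unfolding pst_Seq_If by (simp add: pst_Seq restr_equiv_def)
  then show ?thesis
    using assms(3,4) by (simp add: op_triple_def)
qed

end
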